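(* Let $k \geq 2$ be an integer and let $G=(D\cup I,E)$ be a split graph. If the corresponding hypergraph $H(G)$ admits a bipanchromatic $k$-coloring, then $G$ has $k$ completely independent spanning trees.
   Context: All graphs are finite, simple and undirected. A split graph $G=(D\cup I,E)$ is a graph whose vertex set is partitioned into a clique $D$ and an independent set $I$; the paper assumes throughout that every vertex of $D$ is adjacent to at least one vertex of $I$. Its corresponding hypergraph is $H(G)=(D,\mathcal{E})$ with $\mathcal{E}=\{N_G(x) : x\in I\}$ (one hyperedge $N_G(x)$ for each $x\in I$). A panchromatic $k$-coloring of a hypergraph is an assignment of colors from $\{1,\dots,k\}$ to its vertices such that every hyperedge contains at least one vertex of each of the $k$ colors. It is bipanchromatic if moreover each of the $k$ colors is assigned to at least two vertices of the hypergraph. Spanning trees $T_1,\dots,T_k$ of a graph are completely independent spanning trees if for every pair of vertices $x,y$ the $(x,y)$-paths in $T_1,\dots,T_k$ are pairwise edge-disjoint and have no common internal vertex. *)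

theory Defs
  imports "Graph_Theory.Graph_Theory" "HOL-Library.Multiset"
begin

text \<open>
  Finite simple undirected graphs are represented by the locale \<open>pair_graph\<close> (finite, symmetric,
  loop-free digraphs without parallel arcs): an undirected edge is a pair of opposite arcs.
\<close>

definition neighbours :: "'a pair_pre_digraph \<Rightarrow> 'a \<Rightarrow> 'a set" where
  "neighbours G x = {y. (x, y) \<in> parcs G}"

definition clique :: "'a pair_pre_digraph \<Rightarrow> 'a set \<Rightarrow> bool" where
  "clique G D \<longleftrightarrow> D \<subseteq> pverts G \<and> (\<forall>u\<in>D. \<forall>v\<in>D. u \<noteq> v \<longrightarrow> (u, v) \<in> parcs G)"

definition independent_set :: "'a pair_pre_digraph \<Rightarrow> 'a set \<Rightarrow> bool" where
  "independent_set G I \<longleftrightarrow> I \<subseteq> pverts G \<and> (\<forall>u\<in>I. \<forall>v\<in>I. (u, v) \<notin> parcs G)"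

definition split_graph :: "'a pair_pre_digraph \<Rightarrow> 'a set \<Rightarrow> 'a set \<Rightarrow> bool" where
  "split_graph G D I \<longleftrightarrow>
     pair_graph G \<and> pverts G = D \<union> I \<and> D \<inter> I = {} \<and> clique G D \<and> independent_set G I"


text \<open>Hyperedges form a multiset, since distinct vertices may have the same neighbourhood.\<close>

record 'a hypergraph =
  hverts :: "'a set"
  hedges :: "'a set multiset"

definition split_hypergraph :: "'a pair_pre_digraph \<Rightarrow> 'a set \<Rightarrow> 'a set \<Rightarrow> 'a hypergraph" where
  "split_hypergraph G D I =
     \<lparr> hverts = D, hedges = image_mset (neighbours G) (mset_set I) \<rparr>"

definition panchromatic :: "nat \<Rightarrow> 'a hypergraph \<Rightarrow> ('a \<Rightarrow> nat) \<Rightarrow> bool" where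
  "panchromatic k H c \<longleftrightarrow>
     (\<forall>v\<in>hverts H. c v \<in> {1..k}) \<and>
     (\<forall>e. e \<in># hedges H \<longrightarrow> (\<forall>i\<in>{1..k}. \<exists>v\<in>e. c v = i))"

definition bipanchromatic :: "nat \<Rightarrow> 'a hypergraph \<Rightarrow> ('a \<Rightarrow> nat) \<Rightarrow> bool" where
  "bipanchromatic k H c \<longleftrightarrow>
     panchromatic k H c \<and> (\<forall>i\<in>{1..k}. card {v \<in> hverts H. c v = i} \<ge> 2)"


text \<open>
  The library predicates \<open>forest\<close>, \<open>tree\<close> and \<open>spanning_tree\<close> are for digraphs: in a symmetric
  digraph, \<open>cycle\<close> also accepts an edge traversed back and forth. As the graphs here have no loops
  or parallel edges, the cycles of the undirected graph are exactly those of length at least 3.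
\<close>

definition undirected_tree :: "'a pair_pre_digraph \<Rightarrow> bool" where
  "undirected_tree T \<longleftrightarrow>
     pair_graph T \<and> connected (with_proj T) \<and>
     \<not> (\<exists>p. pre_digraph.cycle (with_proj T) p \<and> length p \<ge> 3)"

definition undirected_spanning_tree :: "'a pair_pre_digraph \<Rightarrow> 'a pair_pre_digraph \<Rightarrow> bool" where
  "undirected_spanning_tree T G \<longleftrightarrow> undirected_tree T \<and> spanning (with_proj T) (with_proj G)"

text \<open>The undirected edges of a path; two paths may use a common edge in opposite directions.\<close>

definition path_edges :: "('a \<times> 'a) awalk \<Rightarrow> 'a set set" where
  "path_edges p = (\<lambda>(u, v). {u, v}) ` set p"

definition path_inner_verts :: "'a pair_pre_digraph \<Rightarrow> ('a \<times> 'a) awalk \<Rightarrow> 'a set" where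
  "path_inner_verts T p = set (pre_digraph.inner_verts (with_proj T) p)"

text \<open>
  In a tree the path between two vertices exists and is unique, so quantifying over all
  \<open>x\<close>-\<open>y\<close>-paths of \<open>T i\<close> and \<open>T j\<close> speaks about the \<open>x\<close>-\<open>y\<close>-path of each tree.
\<close>

definition completely_independent_spanning_trees ::
    "'a pair_pre_digraph \<Rightarrow> nat \<Rightarrow> (nat \<Rightarrow> 'a pair_pre_digraph) \<Rightarrow> bool" where
  "completely_independent_spanning_trees G k T \<longleftrightarrow>
     (\<forall>i\<in>{1..k}. undirected_spanning_tree (T i) G) \<and>
     (\<forall>x\<in>pverts G. \<forall>y\<in>pverts G. \<forall>i\<in>{1..k}. \<forall>j\<in>{1..k}. i \<noteq> j \<longrightarrow>
        (\<forall>p q. pre_digraph.apath (with_proj (T i)) x p y \<longrightarrow>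
               pre_digraph.apath (with_proj (T j)) x q y \<longrightarrow>
               path_edges p \<inter> path_edges q = {} \<and>
               path_inner_verts (T i) p \<inter> path_inner_verts (T j) q = {}))"

end

theory Submission
  imports Defs
begin

text \<open>
  The inner vertices of the \<open>i\<close>-th tree have colour \<open>i\<close> in \<open>D\<close>: its vertices of that colour form a star
  around one of them, and every other vertex is a leaf attached to a neighbour of colour \<open>i\<close>. The
  trees then have disjoint sets of inner vertices, and a common edge of the \<open>i\<close>-th and \<open>j\<close>-th tree
  would have to join \<open>v\<close> of colour \<open>i\<close> and \<open>w\<close> of colour \<open>j\<close> that are attached to each other. Two
  vertices \<open>a i\<close>, \<open>b i\<close> of each colour suffice to avoid this: for \<open>i < j\<close>, the
  arrows of the 4-cycle \<open>a i \<rightarrow> a j \<rightarrow> b i \<rightarrow> b j \<rightarrow> a i\<close> point from vertices to their attachments, and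
  the remaining vertices of the two colours are attached to \<open>a j\<close> and \<open>a i\<close>, respectively.
\<close>

section \<open>Trees given by parent functions\<close>

lemma pcas_nth_Suc: "pcas u p v \<Longrightarrow> Suc m < length p \<Longrightarrow> fst (p ! Suc m) = snd (p ! m)"
proof (induction p arbitrary: u m)
  case (Cons e p)
  then show ?case by (cases m; cases p) auto
qed simp

lemma pcas_closed_nth:
  assumes "pcas u p u" "m < length p"
  shows "fst (p ! (Suc m mod length p)) = snd (p ! m)"
proof (cases "Suc m < length p")
  case True
  then show ?thesis using pcas_nth_Suc[OF assms(1)] by simp
next
  case False
  with assms(2) have m: "m = length p - 1" "p \<noteq> []" by auto
  \<comment> \<open>This serves the wrap-around index: in a closed walk the last arc ends where the
    first one starts.\<close>
  have "fst (hd q) = u \<and> snd (last q) = v" if "pcas u q v" "q \<noteq> []" for u q v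
    using that by (induction u q v rule: pcas.induct) auto
  from this[OF assms(1) m(2)] m show ?thesis by (simp add: hd_conv_nth last_conv_nth)
qed

lemma Suc_mod_surj: "i < n \<Longrightarrow> \<exists>j<n. Suc j mod n = i"
  by (rule exI[of _ "if i = 0 then n - 1 else i - 1"]) auto

text \<open>The arc after \<open>e\<close> leaves \<open>snd e\<close>, and the arc before
  \<open>e\<close> has head \<open>fst e\<close>. With length at least 3 these two arcs are
  different, and different arcs of a cycle have different heads.\<close>

lemma cycle_vertex_two_neighbours:
  assumes "pre_digraph.cycle (with_proj T) p" "length p \<ge> 3" "e \<in> set p"
  obtains w where "(snd e, w) \<in> set p" "w \<noteq> fst e"
proof -
  let ?n = "length p"
  from assms(1) obtain u where u: "pcas u p u" "distinct (map snd p)"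
    by (auto simp: pre_digraph.cycle_def pre_digraph.awalk_def cas_with_proj_eq
        pre_digraph.awalk_verts_conv')
  from assms(3) obtain i where i: "i < ?n" "e = p ! i" by (auto simp: in_set_conv_nth)
  let ?k = "Suc i mod ?n"
  obtain j where j: "j < ?n" "Suc j mod ?n = i" using Suc_mod_surj[OF i(1)] by blast
  have k: "?k < ?n" using i by (intro mod_less_divisor) linarith
  have "j \<noteq> ?k" using i j assms(2) by (auto simp: mod_Suc split: if_splits)
  then have "map snd p ! ?k \<noteq> map snd p ! j"
    using nth_eq_iff_index_eq[OF u(2), of ?k j] j(1) k by simp
  then have "snd (p ! ?k) \<noteq> fst e" using pcas_closed_nth[OF u(1) j(1)] j k i by simp
  moreover have "(snd e, snd (p ! ?k)) \<in> set p"
    using pcas_closed_nth[OF u(1) i(1)] i(2) nth_mem[OF k] by (cases "p ! ?k") simp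
  ultimately show ?thesis by (rule that[rotated])
qed

text \<open>\<open>depth\<close> need not be the distance to \<open>r\<close>: any measure that
  drops from child to parent excludes circular parent chains. The value \<open>parent r\<close> is
  arbitrary.\<close>

locale rooted_tree =
  fixes V :: "'a set" and r :: 'a and parent :: "'a \<Rightarrow> 'a" and depth :: "'a \<Rightarrow> nat"
  assumes finite_V: "finite V"
    and root: "r \<in> V"
    and parent_in_V: "v \<in> V \<Longrightarrow> v \<noteq> r \<Longrightarrow> parent v \<in> V"
    and depth_parent: "v \<in> V \<Longrightarrow> v \<noteq> r \<Longrightarrow> depth (parent v) < depth v"
begin

definition graph :: "'a pair_pre_digraph" where
  "graph = \<lparr> pverts = V,
     parcs = {(u, v). u \<in> V - {r} \<and> v = parent u \<or> v \<in> V - {r} \<and> u = parent v} \<rparr>"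

lemma pverts_graph [simp]: "pverts graph = V"
  by (simp add: graph_def)

lemma arc_iff:
  "(u, v) \<in> parcs graph \<longleftrightarrow> u \<in> V - {r} \<and> v = parent u \<or> v \<in> V - {r} \<and> u = parent v"
  by (simp add: graph_def)

lemma pair_graph_graph: "pair_graph graph"
proof -
  have sub: "parcs graph \<subseteq> V \<times> V" using parent_in_V by (auto simp: graph_def)
  then have "finite (parcs graph)" using finite_V by (meson finite_SigmaI finite_subset)
  moreover have "fst e \<noteq> snd e" if "e \<in> parcs graph" for e
    using that depth_parent by (cases e) (force simp: arc_iff)
  moreover have "symmetric (with_proj graph)"
    by (auto simp: symmetric_def sym_def arc_iff)
  ultimately show ?thesis using sub finite_V by unfold_locales auto
qed

sublocale pair_graph graph by (rule pair_graph_graph)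

lemma connected_graph: "connected (with_proj graph)"
proof -
  have sym: "symmetric (with_proj graph)" using sym_arcs by simp
  have to_root: "v \<rightarrow>\<^sup>*\<^bsub>with_proj graph\<^esub> r" if "v \<in> V" for v
    using that
  proof (induction "depth v" arbitrary: v rule: less_induct)
    case less
    show ?case
    proof (cases "v = r")
      case True
      then show ?thesis using root by simp
    next
      case False
      with less.prems have "(v, parent v) \<in> parcs graph" by (simp add: arc_iff)
      moreover have "parent v \<rightarrow>\<^sup>*\<^bsub>with_proj graph\<^esub> r"
        using less False parent_in_V depth_parent by blast
      ultimately show ?thesis using adj_reachable_trans[of v "parent v" r] by simp
    qed
  qed
  have "u \<rightarrow>\<^sup>*\<^bsub>with_proj graph\<^esub> v" if "u \<in> V" "v \<in> V" for u v
    using reachable_trans[OF to_root[OF that(1)] symmetric_reachable[OF sym to_root[OF that(2)]]] .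
  then show ?thesis
    unfolding connected_def using root
    by (intro strongly_connectedI) (auto simp: reachable_mk_symmetric_eq[OF sym])
qed

lemma no_cycle:
  assumes "cycle p" "length p \<ge> 3"
  shows False
proof -
  have arcs: "set p \<subseteq> parcs graph" and "p \<noteq> []"
    using assms(1) by (auto simp: cycle_def awalk_def)
  define m where "m = Max ((depth \<circ> snd) ` set p)"
  have le: "depth (snd e) \<le> m" if "e \<in> set p" for e
    using that by (auto simp: m_def)
  have "m \<in> (depth \<circ> snd) ` set p"
    unfolding m_def using \<open>p \<noteq> []\<close> by (intro Max_in) auto
  then obtain e where e: "e \<in> set p" "depth (snd e) = m" by auto
  obtain w where w: "(snd e, w) \<in> set p" "w \<noteq> fst e"
    using cycle_vertex_two_neighbours[OF assms e(1)] .
  \<comment> \<open>The bound \<open>le\<close> speaks of heads of arcs only, so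
    \<open>fst e\<close> has to be seen as the head of the preceding arc.\<close>
  obtain d where d: "d \<in> set p" "snd d = fst e"
  proof -
    from assms(1) obtain u where u: "pcas u p u" by (auto simp: cycle_def awalk_def)
    from e(1) obtain i where i: "i < length p" "e = p ! i" by (auto simp: in_set_conv_nth)
    obtain j where "j < length p" "Suc j mod length p = i" using Suc_mod_surj[OF i(1)] by blast
    with pcas_closed_nth[OF u, of j] i(2) that[of "p ! j"] show ?thesis by simp
  qed
  \<comment> \<open>Both neighbours of the deepest vertex \<open>snd e\<close> of the cycle are its parent.\<close>
  have "(fst e, snd e) \<in> parcs graph" using arcs e(1) by auto
  moreover have False if "fst e \<in> V - {r}" "snd e = parent (fst e)"
    using depth_parent[of "fst e"] that(1) le[OF d(1)] d(2) e(2) unfolding that(2)[symmetric] by simp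
  ultimately have "fst e = parent (snd e)"
    unfolding arc_iff by blast
  moreover have "w = parent (snd e)"
  proof -
    have "(snd e, w) \<in> parcs graph" using arcs w(1) by auto
    moreover have False if "w \<in> V - {r}" "snd e = parent w"
      using depth_parent[of w] that(1) le[OF w(1)] e(2) unfolding that(2)[symmetric] by simp
    ultimately show ?thesis unfolding arc_iff by blast
  qed
  ultimately show False using w(2) by simp
qed

lemma undirected_tree_graph: "undirected_tree graph"
  unfolding undirected_tree_def using pair_graph_graph connected_graph no_cycle by blast

text \<open>An inner vertex has two distinct neighbours on the path. At most one of them is its
  parent, so the other is its child.\<close>

lemma path_inner_verts_subset:
  assumes "apath x p y"
  shows "path_inner_verts graph p \<subseteq> parent ` (V - {r})"
proof
  fix v assume "v \<in> path_inner_verts graph p"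
  then have v: "v \<in> set (awalk_verts x p)" "v \<noteq> x" "v \<noteq> y"
    unfolding path_inner_verts_def set_inner_verts[OF assms] by auto
  have "pcas x p y" "set p \<subseteq> parcs graph" using assms by (auto simp: apath_def awalk_def)
  then have "v \<in> snd ` set p"
    using v awalk_verts_conv'[of x p y] by (cases p) auto
  then obtain u where u: "(u, v) \<in> set p" by force
  obtain p1 w p2 where "p = p1 @ (u, v) # (v, w) # p2" "u \<noteq> w"
    using apath_succ_decomp[OF assms u v(3)] by blast
  then have w: "(v, w) \<in> set p" "u \<noteq> w" by simp_all
  have "(u, v) \<in> parcs graph" "(v, w) \<in> parcs graph"
    using u w \<open>set p \<subseteq> parcs graph\<close> by auto
  then show "v \<in> parent ` (V - {r})"
    using w(2) unfolding arc_iff by blast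
qed

lemma path_edges_subset:
  assumes "apath x p y"
  shows "path_edges p \<subseteq> (\<lambda>v. {v, parent v}) ` (V - {r})"
proof -
  have "{u, v} \<in> (\<lambda>v. {v, parent v}) ` (V - {r})" if "(u, v) \<in> parcs graph" for u v
    using that unfolding arc_iff by (auto simp: insert_commute)
  moreover have "set p \<subseteq> parcs graph" using assms by (auto simp: apath_def awalk_def)
  ultimately show ?thesis by (auto simp: path_edges_def)
qed

end

text \<open>This removes paths from the problem: inner vertices of paths are parents, which
  \<open>inner\<close> separates, and edges of paths join a vertex to its parent, where
  \<open>mutual\<close> forbids a common edge.\<close>

lemma completely_independent_if_parents:
  fixes G :: "'a pair_pre_digraph"
  assumes "pair_graph G"
    and tree: "\<And>i. i \<in> {1..k} \<Longrightarrow> rooted_tree (pverts G) (r i) (f i) (depth i)"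
    and edge: "\<And>i v. i \<in> {1..k} \<Longrightarrow> v \<in> pverts G \<Longrightarrow> v \<noteq> r i \<Longrightarrow> (v, f i v) \<in> parcs G"
    and inner: "\<And>i j. i \<in> {1..k} \<Longrightarrow> j \<in> {1..k} \<Longrightarrow> i \<noteq> j \<Longrightarrow>
      f i ` (pverts G - {r i}) \<inter> f j ` (pverts G - {r j}) = {}"
    and mutual: "\<And>i j v. i \<in> {1..k} \<Longrightarrow> j \<in> {1..k} \<Longrightarrow> i \<noteq> j \<Longrightarrow>
      v \<in> pverts G \<Longrightarrow> v \<noteq> r i \<Longrightarrow> f i v \<noteq> r j \<Longrightarrow> f j (f i v) \<noteq> v"
  shows "completely_independent_spanning_trees G k (\<lambda>i. rooted_tree.graph (pverts G) (r i) (f i))"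
proof -
  interpret G: pair_graph G by fact
  let ?V = "pverts G"
  let ?T = "\<lambda>i. rooted_tree.graph ?V (r i) (f i)"
  have spanning: "undirected_spanning_tree (?T i) G" if i: "i \<in> {1..k}" for i
  proof -
    interpret T: rooted_tree ?V "r i" "f i" "depth i" by (rule tree[OF i])
    have "parcs (?T i) \<subseteq> parcs G"
      using edge[OF i] G.arcs_symmetric by (auto simp: T.arc_iff)
    then have "subgraph (with_proj (?T i)) (with_proj G)"
      using G.wf_digraph T.wf_digraph by (auto simp: subgraph_def)
    then show ?thesis
      by (simp add: undirected_spanning_tree_def spanning_def T.undirected_tree_graph)
  qed
  have disjoint: "path_edges p \<inter> path_edges q = {} \<and>
      path_inner_verts (?T i) p \<inter> path_inner_verts (?T j) q = {}"
    if i: "i \<in> {1..k}" and j: "j \<in> {1..k}" and "i \<noteq> j"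
      and p: "pre_digraph.apath (with_proj (?T i)) x p y"
      and q: "pre_digraph.apath (with_proj (?T j)) x q y" for i j x y p q
  proof -
    interpret Ti: rooted_tree ?V "r i" "f i" "depth i" by (rule tree[OF i])
    interpret Tj: rooted_tree ?V "r j" "f j" "depth j" by (rule tree[OF j])
    note inner = inner[OF i j \<open>i \<noteq> j\<close>]
    \<comment> \<open>Equal edges either have equal parent ends, against \<open>inner\<close>, or
      are traversed oppositely, so that \<open>w = f i v\<close> and \<open>f j w = v\<close>,
      against \<open>mutual\<close>.\<close>
    have "{v, f i v} \<noteq> {w, f j w}" if "v \<in> ?V - {r i}" "w \<in> ?V - {r j}" for v w
      using that inner mutual[OF i j \<open>i \<noteq> j\<close>, of v] by (auto simp: doubleton_eq_iff)
    then have "path_edges p \<inter> path_edges q = {}"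
      using Ti.path_edges_subset[OF p] Tj.path_edges_subset[OF q] by blast
    then show ?thesis
      using inner Ti.path_inner_verts_subset[OF p] Tj.path_inner_verts_subset[OF q] by blast
  qed
  show ?thesis
    unfolding completely_independent_spanning_trees_def using spanning disjoint by blast
qed

section \<open>Split graphs with a bipanchromatic colouring\<close>

theorem theorem5:
  fixes G :: "'a pair_pre_digraph" and D I :: "'a set" and k :: nat
  assumes "k \<ge> 2"
    and "split_graph G D I"
    and "\<forall>d\<in>D. \<exists>x\<in>I. (d, x) \<in> parcs G"
    and "\<exists>c. bipanchromatic k (split_hypergraph G D I) c"
  shows "\<exists>T. completely_independent_spanning_trees G k T"
proof -
  from assms(2) have G: "pair_graph G" and V: "pverts G = D \<union> I" and DI: "D \<inter> I = {}"
    and clique: "\<And>u v. u \<in> D \<Longrightarrow> v \<in> D \<Longrightarrow> u \<noteq> v \<Longrightarrow> (u, v) \<in> parcs G"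
    and indep: "\<And>u v. u \<in> I \<Longrightarrow> v \<in> I \<Longrightarrow> (u, v) \<notin> parcs G"
    by (auto simp: split_graph_def clique_def independent_set_def)
  interpret G: pair_graph G by fact
  have fin: "finite (D \<union> I)" using G.pair_finite_verts V by simp
  from assms(4) obtain c where c: "bipanchromatic k (split_hypergraph G D I) c" by blast
  have "\<exists>y\<in>D. (x, y) \<in> parcs G \<and> c y = i" if "x \<in> I" "i \<in> {1..k}" for x i
  proof -
    have "\<exists>y\<in>neighbours G x. c y = i"
      using c that fin by (auto simp: bipanchromatic_def panchromatic_def split_hypergraph_def)
    then obtain y where "(x, y) \<in> parcs G" "c y = i" by (auto simp: neighbours_def)
    then show ?thesis using G.in_arcsD2 V indep that by blast
  qed
  then obtain g where g: "\<And>x i. x \<in> I \<Longrightarrow> i \<in> {1..k} \<Longrightarrow>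
      g x i \<in> D \<and> (x, g x i) \<in> parcs G \<and> c (g x i) = i"
    by metis
  have col: "c v \<in> {1..k}" if "v \<in> D" for v
    using c that by (auto simp: bipanchromatic_def panchromatic_def split_hypergraph_def)
  have "\<exists>a b. a \<in> D \<and> b \<in> D \<and> a \<noteq> b \<and> c a = i \<and> c b = i" if "i \<in> {1..k}" for i
  proof -
    have "card {v \<in> D. c v = i} \<ge> 2"
      using c that by (auto simp: bipanchromatic_def split_hypergraph_def)
    then show ?thesis by (fastforce simp: numeral_2_eq_2 card_le_Suc_iff)
  qed
  then obtain a b where ab: "\<And>i. i \<in> {1..k} \<Longrightarrow>
      a i \<in> D \<and> b i \<in> D \<and> a i \<noteq> b i \<and> c (a i) = i \<and> c (b i) = i"
    by metis
  \<comment> \<open>The last two branches encode the arrows of the 4-cycle, seen from a vertex of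
    colour below or above \<open>i\<close>. The root \<open>a i\<close> is mapped to itself.\<close>
  define f where "f i v =
    (if v \<in> I then g v i
     else if c v = i then a i
     else if c v < i then (if v = b (c v) then b i else a i)
     else if v = a (c v) then b i else a i)" for i v
  \<comment> \<open>Level 1 holds every possible parent other than the root. Vertices of level 2 may
    still hang directly from \<open>a i\<close>.\<close>
  define depth :: "nat \<Rightarrow> 'a \<Rightarrow> nat" where
    "depth i v = (if v = a i then 0 else if v \<in> D \<and> c v = i then 1 else 2)" for i v
  have f: "f i v \<in> D" "c (f i v) = i" if "i \<in> {1..k}" for i v
    using that g ab by (auto simp: f_def)
  have "rooted_tree (pverts G) (a i) (f i) (depth i)" if i: "i \<in> {1..k}" for i
  proof
    show "depth i (f i v) < depth i v" if "v \<in> pverts G" "v \<noteq> a i" for v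
      using that f[OF i, of v] DI V by (auto simp: depth_def f_def)
  qed (use fin V ab[OF i] f(1)[OF i] in auto)
  moreover have "(v, f i v) \<in> parcs G" if i: "i \<in> {1..k}" and v: "v \<in> pverts G" "v \<noteq> a i" for i v
  proof (cases "v \<in> I")
    case True
    then show ?thesis using g[OF True i] by (simp add: f_def)
  next
    case False
    moreover have "v \<noteq> f i v" using False v f(2)[OF i, of v] by (auto simp: f_def)
    ultimately show ?thesis using clique f(1)[OF i] v V by blast
  qed
  moreover have "f i ` (pverts G - {a i}) \<inter> f j ` (pverts G - {a j}) = {}"
    if "i \<in> {1..k}" "j \<in> {1..k}" "i \<noteq> j" for i j
    using that f(2) by (auto dest!: arg_cong[where f = c])
  moreover have "f j (f i v) \<noteq> v"
    if i: "i \<in> {1..k}" and j: "j \<in> {1..k}" and ij: "i \<noteq> j" for i j v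
  proof
    assume eq: "f j (f i v) = v"
    have v: "v \<in> D" "c v = j" using f[OF j, of "f i v"] eq by auto
    have w: "f i v \<in> D" "c (f i v) = i" using f[OF i] by auto
    \<comment> \<open>Both vertices, being parents, lie in \<open>D\<close>. Hence \<open>v\<close>
      is \<open>a j\<close> or \<open>b j\<close> and \<open>f i v\<close> is \<open>a i\<close> or
      \<open>b i\<close>, and the directed 4-cycle on these has no arrow together with its
      reverse.\<close>
    have "v \<notin> I" "f i v \<notin> I" using v w DI by auto
    with eq v w ij ab[OF i] ab[OF j] show False
      by (auto simp: f_def split: if_splits)
  qed
  ultimately have "completely_independent_spanning_trees G k
      (\<lambda>i. rooted_tree.graph (pverts G) (a i) (f i))"
    by (intro completely_independent_if_parents[OF G]) auto
  then show ?thesis by blast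
qed

end
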